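(* Let $f,g:\mathbb{R}^d\to\mathbb{R}$ be (differentiable) convex functions, and let $w^\ast$ be a solution of the problem $\min_{w\in\mathbb{R}^d} f(w)$ subject to $g(w)\le 0$. Consider the soft switching proximal point method, which from the initial point $w_1\in\mathbb{R}^d$ generates iterates by the implicit update $$w_{t+1}=w_t-\eta F(w_{t+1}),\qquad F(w)=\sigma_\beta(g(w)-\epsilon)\nabla g(w)+[1-\sigma_\beta(g(w)-\epsilon)]\nabla f(w),$$ where $\sigma_\beta(x)=\min\{1,\max\{0,1+\beta x\}\}$. Define $D:=\|w_1-w^\ast\|$ and $$\mathcal{A}=\{t\in\{1,\dots,T\} : g(w_t)<\epsilon\},\qquad \bar w=\sum_{t\in\mathcal{A}}\alpha_t w_t,\qquad \alpha_t=\frac{1-\sigma_\beta(g(w_t)-\epsilon)}{\sum_{s\in\mathcal{A}}[1-\sigma_\beta(g(w_s)-\epsilon)]}.$$ Suppose the nonlinear equation $w=w_t-\eta F(w)$ (in the unknown $w$, defining $w_{t+1}$) has a solution for all $t$. Then if $$\epsilon=\frac{D^2}{\eta T},\qquad \eta>0,\qquad \beta=\frac{2}{\epsilon},$$ it holds that $\mathcal{A}$ is nonempty, $\bar w$ is well-defined, and $\bar w$ is an $\epsilon$-solution of the problem, i.e. $f(\bar w)-f(w^\ast)\le\epsilon$ and $g(\bar w)\le\epsilon$.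
   Context: $\|\cdot\|$ is the Euclidean norm on $\mathbb{R}^d$, $T\ge 1$ is the number of iterates considered, $\eta$ is the step size, $\epsilon>0$ is the constraint violation tolerance, and $\beta>0$ is the smoothing parameter of the switching function $\sigma_\beta$ (the "trimmed hinge", i.e. the projection of $1+\beta x$ onto $[0,1]$).
   Formalization: The set A, and hence the average, ranges over t in {2,…,T+1} (the T iterates generated from w_1) instead of {1,…,T}; with w_1 included the claim is false, e.g. g = −1, f(x) = cx²/2 with c > 2T, w_1 = 1, η = 1. *)

theory Defs
  imports "HOL-Analysis.Analysis"
begin

definition gradient :: "('a::real_inner \<Rightarrow> real) \<Rightarrow> 'a \<Rightarrow> 'a" where
  "gradient f x = (THE D. GDERIV f x :> D)"

definition is_minimizer :: "('a \<Rightarrow> real) \<Rightarrow> ('a \<Rightarrow> real) \<Rightarrow> 'a \<Rightarrow> bool" where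
  "is_minimizer f g w \<longleftrightarrow> g w \<le> 0 \<and> (\<forall>v. g v \<le> 0 \<longrightarrow> f w \<le> f v)"

definition is_eps_solution ::
  "('a \<Rightarrow> real) \<Rightarrow> ('a \<Rightarrow> real) \<Rightarrow> 'a \<Rightarrow> real \<Rightarrow> 'a \<Rightarrow> bool" where
  "is_eps_solution f g wopt eps w \<longleftrightarrow> f w - f wopt \<le> eps \<and> g w \<le> eps"

definition trimmed_hinge :: "real \<Rightarrow> real \<Rightarrow> real" where
  "trimmed_hinge \<beta> x = min 1 (max 0 (1 + \<beta> * x))"

definition switching_field ::
  "('a::real_inner \<Rightarrow> real) \<Rightarrow> ('a \<Rightarrow> real) \<Rightarrow> real \<Rightarrow> real \<Rightarrow> 'a \<Rightarrow> 'a" where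
  "switching_field f g \<beta> eps w =
     trimmed_hinge \<beta> (g w - eps) *\<^sub>R gradient g w +
     (1 - trimmed_hinge \<beta> (g w - eps)) *\<^sub>R gradient f w"

text \<open>The run starts at \<open>w 1\<close> and its \<open>T\<close> implicit steps produce \<open>w 2, \<dots>, w (T + 1)\<close>;
  these are the iterates that are averaged. The starting point must be left out: no step evaluates
  the field there, so \<open>f (w 1)\<close> and \<open>g (w 1)\<close> are unconstrained, and with index
  range \<open>{1..T}\<close> the average need not be an \<open>eps\<close>-solution for any \<open>T\<close>.
  For example, take \<open>g = -1\<close>, \<open>f x = (c / 2) * x\<^sup>2\<close> on the line, \<open>w 1 = 1\<close>, step size 1
  and \<open>c > 2 * T\<close>: the average over \<open>{1..T}\<close> is at least \<open>1 / T\<close>, so its objective gap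
  is at least \<open>c / (2 * T\<^sup>2)\<close>, which exceeds \<open>eps = 1 / T\<close>.\<close>

definition active_iterates ::
  "('a \<Rightarrow> real) \<Rightarrow> real \<Rightarrow> (nat \<Rightarrow> 'a) \<Rightarrow> nat \<Rightarrow> nat set" where
  "active_iterates g eps w T = {t \<in> {2..T + 1}. g (w t) < eps}"

definition total_weight ::
  "('a \<Rightarrow> real) \<Rightarrow> real \<Rightarrow> real \<Rightarrow> (nat \<Rightarrow> 'a) \<Rightarrow> nat set \<Rightarrow> real" where
  "total_weight g \<beta> eps w A = (\<Sum>s\<in>A. 1 - trimmed_hinge \<beta> (g (w s) - eps))"

definition averaging_weight ::
  "('a \<Rightarrow> real) \<Rightarrow> real \<Rightarrow> real \<Rightarrow> (nat \<Rightarrow> 'a) \<Rightarrow> nat set \<Rightarrow> nat \<Rightarrow> real" where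
  "averaging_weight g \<beta> eps w A t =
     (1 - trimmed_hinge \<beta> (g (w t) - eps)) / total_weight g \<beta> eps w A"

definition averaged_iterate ::
  "('a::real_vector \<Rightarrow> real) \<Rightarrow> real \<Rightarrow> real \<Rightarrow> (nat \<Rightarrow> 'a) \<Rightarrow> nat set \<Rightarrow> 'a" where
  "averaged_iterate g \<beta> eps w A = (\<Sum>t\<in>A. averaging_weight g \<beta> eps w A t *\<^sub>R w t)"

end

theory Submission
  imports Defs
begin

text \<open>
  Write \<open>s t\<close> for the hinge value at \<open>w t\<close>. Expanding the square of
  \<open>w t - wopt = (w (t + 1) - wopt) + \<eta> F (w (t + 1))\<close> and applying the gradient inequality at
  \<open>w (t + 1)\<close> shows that \<open>s * g + (1 - s) * (f - f wopt)\<close>, summed over the new iterates, is at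
  most \<open>D\<^sup>2 / (2 \<eta>) = eps T / 2\<close>. Since \<open>\<beta> = 2 / eps\<close>, the hinge vanishes wherever
  \<open>g \<le> eps / 2\<close>, so \<open>s * g \<ge> s * eps / 2\<close> throughout, and what remains bounds the
  \<open>(1 - s)\<close>-weighted sum of the objective gaps by \<open>eps / 2\<close> times its total weight. If no
  iterate were active, every term would be at least \<open>eps\<close>, contradicting the first bound.
\<close>

text \<open>As \<open>gradient\<close> is a definite description, both existence and uniqueness of
  the representing vector are required.\<close>

lemma GDERIV_gradient:
  fixes f :: "'a::euclidean_space \<Rightarrow> real"
  assumes "f differentiable (at x)"
  shows "GDERIV f x :> gradient f x"
proof -
  obtain f' where f': "(f has_derivative f') (at x)"
    using assms by (auto simp: differentiable_def)
  \<comment> \<open>Riesz representation: the adjoint of a functional sends \<open>1\<close> to the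
    vector representing it.\<close>
  have "f' = (\<lambda>h. inner h (adjoint f' 1))"
    by (simp add: fun_eq_iff adjoint_works[OF has_derivative_linear[OF f']])
  with f' have grad: "GDERIV f x :> adjoint f' 1"
    by (simp add: gderiv_def)
  have unique: "D = D'" if "GDERIV f x :> D" "GDERIV f x :> D'" for D D'
  proof -
    have "(\<lambda>h. inner h D) = (\<lambda>h. inner h D')"
      using that unfolding gderiv_def by (rule has_derivative_unique)
    then show ?thesis
      using vector_eq_ldot[of D D'] by (simp add: fun_eq_iff)
  qed
  show ?thesis
    unfolding gradient_def by (rule theI[where P = "gderiv f x", OF grad unique[OF _ grad]])
qed

text \<open>Restriction to the line from \<open>x\<close> (parameter \<open>0\<close>) to
  \<open>y\<close> (parameter \<open>1\<close>) reduces the claim to the tangent inequality for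
  convex functions of one real variable.\<close>

lemma convex_on_above_gradient:
  fixes f :: "'a::euclidean_space \<Rightarrow> real"
  assumes "convex_on UNIV f" and "f differentiable (at x)"
  shows "f y - f x \<ge> inner (gradient f x) (y - x)"
proof -
  let ?l = "\<lambda>t::real. x + t *\<^sub>R (y - x)"
  have "convex_on UNIV (\<lambda>t. f (?l t))"
  proof (rule convex_onI)
    fix t a b :: real
    assume "0 < t" "t < 1"
    have "?l ((1 - t) *\<^sub>R a + t *\<^sub>R b) = (1 - t) *\<^sub>R ?l a + t *\<^sub>R ?l b"
      by (simp add: algebra_simps)
    with \<open>0 < t\<close> \<open>t < 1\<close>
    show "f (?l ((1 - t) *\<^sub>R a + t *\<^sub>R b)) \<le> (1 - t) * f (?l a) + t * f (?l b)"
      using convex_onD[OF assms(1), of t "?l a" "?l b"] by simp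
  qed simp
  moreover have "((\<lambda>t. f (?l t)) has_field_derivative inner (gradient f x) (y - x)) (at 0)"
  proof -
    have "(?l has_derivative (\<lambda>t. t *\<^sub>R (y - x))) (at 0)"
      by (auto intro!: derivative_eq_intros)
    moreover have "(f has_derivative (\<lambda>h. inner h (gradient f x))) (at (?l 0))"
      using GDERIV_gradient[OF assms(2)] by (simp add: gderiv_def)
    ultimately have "((\<lambda>t. f (?l t)) has_derivative
        (\<lambda>t. inner (t *\<^sub>R (y - x)) (gradient f x))) (at 0)"
      by (rule has_derivative_compose)
    moreover have "(\<lambda>t. inner (t *\<^sub>R (y - x)) (gradient f x))
        = (*) (inner (gradient f x) (y - x))"
      by (simp add: fun_eq_iff inner_commute)
    ultimately show ?thesis
      by (simp add: has_field_derivative_def)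
  qed
  ultimately have "f (?l 1) - f (?l 0) \<ge> inner (gradient f x) (y - x) * (1 - 0)"
    by (intro convex_on_imp_above_tangent[where A = UNIV]) auto
  then show ?thesis
    by simp
qed

lemma trimmed_hinge_nonneg: "0 \<le> trimmed_hinge \<beta> x"
  by (simp add: trimmed_hinge_def)

lemma trimmed_hinge_le_1: "trimmed_hinge \<beta> x \<le> 1"
  by (simp add: trimmed_hinge_def)

lemma trimmed_hinge_eq_1_iff:
  assumes "\<beta> > 0"
  shows "trimmed_hinge \<beta> x = 1 \<longleftrightarrow> x \<ge> 0"
  using assms by (auto simp: trimmed_hinge_def min_def max_def zero_le_mult_iff)

lemma trimmed_hinge_eq_0:
  assumes "\<beta> > 0" and "x \<le> - 1 / \<beta>"
  shows "trimmed_hinge \<beta> x = 0"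
  using assms by (auto simp: trimmed_hinge_def field_simps)

text \<open>Either the hinge vanishes and both sides are \<open>0\<close>, or \<open>u\<close>
  exceeds \<open>eps - 1 / \<beta>\<close>.\<close>

lemma trimmed_hinge_mult_ge:
  assumes "\<beta> > 0"
  shows "trimmed_hinge \<beta> (u - eps) * u \<ge> trimmed_hinge \<beta> (u - eps) * (eps - 1 / \<beta>)"
proof (cases "u - eps \<le> - 1 / \<beta>")
  case True
  then show ?thesis
    using trimmed_hinge_eq_0[OF assms] by simp
next
  case False
  then show ?thesis
    by (intro mult_left_mono trimmed_hinge_nonneg) simp
qed

text \<open>The gradient inequalities for \<open>g\<close> and \<open>f\<close> are mixed with
  weights \<open>s\<close> and \<open>1 - s\<close>; feasibility of \<open>z\<close> removes
  \<open>g z\<close> from the first.\<close>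

lemma switching_field_inner_ge:
  fixes f g :: "'a::euclidean_space \<Rightarrow> real" and \<beta> eps :: real
  assumes "convex_on UNIV f" and "f differentiable (at x)"
    and "convex_on UNIV g" and "g differentiable (at x)" and "g z \<le> 0"
  defines "s \<equiv> trimmed_hinge \<beta> (g x - eps)"
  shows "inner (switching_field f g \<beta> eps x) (x - z) \<ge> s * g x + (1 - s) * (f x - f z)"
proof -
  have "inner (gradient g x) (x - z) \<ge> g x"
    using convex_on_above_gradient[OF assms(3,4), of z] assms(5) by (simp add: inner_diff_right)
  moreover have "inner (gradient f x) (x - z) \<ge> f x - f z"
    using convex_on_above_gradient[OF assms(1,2), of z] by (simp add: inner_diff_right)
  moreover have "0 \<le> s" "s \<le> 1"
    by (simp_all add: s_def trimmed_hinge_nonneg trimmed_hinge_le_1)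
  ultimately have "s * inner (gradient g x) (x - z) + (1 - s) * inner (gradient f x) (x - z)
      \<ge> s * g x + (1 - s) * (f x - f z)"
    by (intro add_mono mult_left_mono) auto
  then show ?thesis
    by (simp add: switching_field_def s_def inner_add_left)
qed

lemma implicit_step_inner_le:
  fixes x y z v :: "'a::real_inner"
  assumes "y = x - \<eta> *\<^sub>R v"
  shows "2 * \<eta> * inner v (y - z) \<le> (norm (x - z))\<^sup>2 - (norm (y - z))\<^sup>2"
proof -
  have "x - z = (y - z) + \<eta> *\<^sub>R v"
    using assms by simp
  then have "(norm (x - z))\<^sup>2 = (norm (y - z))\<^sup>2 + 2 * \<eta> * inner v (y - z) + (norm (\<eta> *\<^sub>R v))\<^sup>2"
    by (simp only: power2_norm_eq_inner)
       (simp add: inner_add_left inner_add_right inner_commute)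
  then show ?thesis
    by (smt (verit) zero_le_power2)
qed

text \<open>The one-step bounds telescope, and the final squared distance is discarded. The index
  \<open>t + 1\<close> of \<open>v\<close> reflects that an implicit step evaluates the field at its
  end point.\<close>

lemma implicit_steps_sum_inner_le:
  fixes w v :: "nat \<Rightarrow> 'a::real_inner"
  assumes "\<And>t. t \<in> {1..T} \<Longrightarrow> w (t + 1) = w t - \<eta> *\<^sub>R v (t + 1)"
  shows "2 * \<eta> * (\<Sum>t = 2..T + 1. inner (v t) (w t - z)) \<le> (norm (w 1 - z))\<^sup>2"
proof -
  have "2 * \<eta> * (\<Sum>t = 2..T + 1. inner (v t) (w t - z))
      \<le> (norm (w 1 - z))\<^sup>2 - (norm (w (T + 1) - z))\<^sup>2"
    using assms
  proof (induction T)
    case (Suc T)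
    have "2 * \<eta> * inner (v (T + 2)) (w (T + 2) - z)
        \<le> (norm (w (T + 1) - z))\<^sup>2 - (norm (w (T + 2) - z))\<^sup>2"
      using Suc.prems[of "T + 1"] by (intro implicit_step_inner_le) simp
    with Suc show ?case
      by (simp add: distrib_left)
  qed simp
  then show ?thesis
    by (smt (verit) zero_le_power2)
qed

text \<open>Strict inequality in \<open>g (w t) < eps\<close> keeps the hinge strictly below
  \<open>1\<close>.\<close>

lemma total_weight_pos:
  assumes "\<beta> > 0" and "finite A" and "A \<noteq> {}" and "\<And>t. t \<in> A \<Longrightarrow> g (w t) < eps"
  shows "total_weight g \<beta> eps w A > 0"
  unfolding total_weight_def
proof (rule sum_pos)
  fix t
  assume "t \<in> A"
  then show "1 - trimmed_hinge \<beta> (g (w t) - eps) > 0"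
    using assms(4) trimmed_hinge_eq_1_iff[OF assms(1)] trimmed_hinge_le_1[of \<beta> "g (w t) - eps"]
    by (smt (verit))
qed (use assms in auto)

text \<open>Jensen's inequality, with the normalisation cleared from the hypothesis; it serves for
  both the objective and the constraint.\<close>

lemma convex_on_averaged_iterate_le:
  assumes "convex_on UNIV h" and "finite A" and W: "total_weight g \<beta> eps w A > 0"
    and le: "(\<Sum>t\<in>A. (1 - trimmed_hinge \<beta> (g (w t) - eps)) * h (w t))
      \<le> (\<Sum>t\<in>A. (1 - trimmed_hinge \<beta> (g (w t) - eps)) * c)"
  shows "h (averaged_iterate g \<beta> eps w A) \<le> c"
proof -
  let ?a = "averaging_weight g \<beta> eps w A"
  have "A \<noteq> {}"
    using W by (auto simp: total_weight_def)
  moreover have "sum ?a A = 1"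
    using W by (simp add: averaging_weight_def total_weight_def flip: sum_divide_distrib)
  moreover have "?a t \<ge> 0" for t
    using W by (simp add: averaging_weight_def trimmed_hinge_le_1)
  ultimately have "h (averaged_iterate g \<beta> eps w A) \<le> (\<Sum>t\<in>A. ?a t * h (w t))"
    unfolding averaged_iterate_def using assms(1,2) by (intro convex_on_sum) auto
  also have "\<dots> \<le> c"
    using W le[folded sum_distrib_right, folded total_weight_def]
    by (simp add: averaging_weight_def pos_divide_le_eq mult.commute flip: sum_divide_distrib)
  finally show ?thesis .
qed

theorem theorem5:
  fixes f g :: "real ^ 'd \<Rightarrow> real"
    and w :: "nat \<Rightarrow> real ^ 'd"
    and wopt :: "real ^ 'd"
    and D \<eta> \<beta> eps :: real
    and T :: nat
    and A :: "nat set"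
  assumes "convex_on UNIV f" and "\<And>x. f differentiable (at x)"
    and "convex_on UNIV g" and "\<And>x. g differentiable (at x)"
    and "is_minimizer f g wopt"
    and "T \<ge> 1" and "\<eta> > 0" and "eps > 0"
    and "D = norm (w 1 - wopt)"
    and "eps = D\<^sup>2 / (\<eta> * real T)"
    and "\<beta> = 2 / eps"
    and "\<And>t. t \<in> {1..T} \<Longrightarrow> w (t + 1) = w t - \<eta> *\<^sub>R switching_field f g \<beta> eps (w (t + 1))"
    and "A = active_iterates g eps w T"
  shows "A \<noteq> {} \<and>
    total_weight g \<beta> eps w A \<noteq> 0 \<and>
    is_eps_solution f g wopt eps (averaged_iterate g \<beta> eps w A)"
proof -
  note f = assms(1,2) and g = assms(3,4) and A = assms(13)[unfolded active_iterates_def]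
  define s where "s t = trimmed_hinge \<beta> (g (w t) - eps)" for t
  let ?gap = "\<lambda>t. f (w t) - f wopt"
  let ?I = "{2..T + 1}"
  have pos: "\<beta> > 0" "real T > 0" "\<eta> > 0" "eps > 0"
    using assms(6-8,11) by simp_all
  have "finite A"
    by (simp add: A)
  have "g wopt \<le> 0"
    using assms(5) by (simp add: is_minimizer_def)
  then have "(\<Sum>t\<in>?I. s t * g (w t) + (1 - s t) * ?gap t)
      \<le> (\<Sum>t\<in>?I. inner (switching_field f g \<beta> eps (w t)) (w t - wopt))"
    unfolding s_def by (intro sum_mono switching_field_inner_ge f g)
  also have "\<dots> \<le> D\<^sup>2 / (2 * \<eta>)"
    using implicit_steps_sum_inner_le[where v = "\<lambda>t. switching_field f g \<beta> eps (w t)"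
        and z = wopt, OF assms(12), of T] pos assms(9)
    by (simp add: pos_le_divide_eq mult.commute)
  also have "\<dots> = eps / 2 * real T"
    using assms(10) pos by (simp add: field_simps)
  finally have energy: "(\<Sum>t\<in>?I. s t * g (w t) + (1 - s t) * ?gap t) \<le> eps / 2 * real T" .
  \<comment> \<open>The lower bound on \<open>g\<close> makes \<open>A\<close> nonempty;
    \<open>s t = 1\<close> means zero weight, so sums over \<open>A\<close> extend to
    \<open>?I\<close>.\<close>
  have inactive: "s t = 1 \<and> g (w t) \<ge> eps" if "t \<in> ?I - A" for t
    using that trimmed_hinge_eq_1_iff[OF pos(1)] by (auto simp: A s_def)
  have "A \<noteq> {}"
  proof
    assume "A = {}"
    then have "(\<Sum>t\<in>?I. eps) \<le> (\<Sum>t\<in>?I. s t * g (w t) + (1 - s t) * ?gap t)"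
      using inactive by (intro sum_mono) simp
    with energy have "eps * real T \<le> eps / 2 * real T"
      by (simp add: mult.commute)
    with pos show False
      by simp
  qed
  then have W: "total_weight g \<beta> eps w A > 0"
    using pos \<open>finite A\<close> by (intro total_weight_pos) (auto simp: A)
  have sum_A: "(\<Sum>t\<in>A. (1 - s t) * h t) = (\<Sum>t\<in>?I. (1 - s t) * h t)" for h
    using inactive by (intro sum.mono_neutral_left) (auto simp: A)
  \<comment> \<open>The choice of \<open>\<beta>\<close> gives
    \<open>eps - 1 / \<beta> = eps / 2\<close>.\<close>
  have "s t * (eps / 2) \<le> s t * g (w t)" for t
    using trimmed_hinge_mult_ge[OF pos(1), of "g (w t)" eps] assms(11)
    by (simp add: s_def algebra_simps)
  then have "(\<Sum>t\<in>?I. s t * (eps / 2)) \<le> (\<Sum>t\<in>?I. s t * g (w t))"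
    by (rule sum_mono)
  with energy have "(\<Sum>t\<in>?I. (1 - s t) * ?gap t)
      \<le> eps / 2 * real T - (\<Sum>t\<in>?I. s t * (eps / 2))"
    by (simp only: sum.distrib)
  \<comment> \<open>\<open>?I\<close> has \<open>T\<close> elements, so
    \<open>eps / 2 * real T\<close> is the sum of the constant \<open>eps / 2\<close>.\<close>
  also have "\<dots> = (\<Sum>t\<in>?I. (1 - s t) * (eps / 2))"
    by (simp only: left_diff_distrib sum_subtractf) simp
  finally have "(\<Sum>t\<in>A. (1 - s t) * ?gap t) \<le> (\<Sum>t\<in>A. (1 - s t) * (eps / 2))"
    by (simp only: sum_A)
  then have "(\<Sum>t\<in>A. (1 - s t) * f (w t)) \<le> (\<Sum>t\<in>A. (1 - s t) * (f wopt + eps / 2))"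
    by (simp only: right_diff_distrib distrib_left sum_subtractf sum.distrib)
  then have "f (averaged_iterate g \<beta> eps w A) \<le> f wopt + eps / 2"
    unfolding s_def by (rule convex_on_averaged_iterate_le[OF f(1) \<open>finite A\<close> W])
  \<comment> \<open>For the constraint no summed bound enters: each active iterate satisfies it by
    definition of \<open>A\<close>.\<close>
  moreover have "(\<Sum>t\<in>A. (1 - s t) * g (w t)) \<le> (\<Sum>t\<in>A. (1 - s t) * eps)"
    by (intro sum_mono mult_left_mono) (auto simp: A s_def trimmed_hinge_le_1)
  then have "g (averaged_iterate g \<beta> eps w A) \<le> eps"
    unfolding s_def
    by (rule convex_on_averaged_iterate_le[OF g(1) \<open>finite A\<close> W])
  ultimately show ?thesis
    using \<open>A \<noteq> {}\<close> W pos by (simp add: is_eps_solution_def)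
qed

end
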